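(* Let $k>1$, $r>3$ and $n>k$ be integers and let $j$ be permissible for $(r,n,k)$, i.e. $k(r-1)+1\le j\le n(r-1)+1-\left\lceil\frac{n-(k-1)}{k+1}\right\rceil$. Then $$\begin{aligned}F_k(r,n,j)={}&\sum_{i=0}^{r-2}\binom{r-2}{i}F_k(r,n-2,j-i-(r-1))+\sum_{i=0}^{r-2}\binom{r-1}{i}F_k(r,n-1,j-i)\\&+\sum_{l=1}^{k-1}\sum_{i=0}^{r-3}\binom{r-2}{i}F_k(r,n-(l+1),j-l(r-1)-1-i)\\&+\sum_{l=1}^{k-1}\sum_{i=0}^{r-2}\binom{r-2}{i}F_k(r,n-(l+2),j-(l+1)(r-1)-i).\end{aligned}$$
   Context: An $r$-uniform hypergraph has a vertex set and an edge set, each edge being an $r$-element set of vertices. A loose $r$-path of length $n$ is an $r$-uniform hypergraph (without isolated vertices) with $n$ edges that can be ordered $E_1,\dots,E_n$ so that $|E_i\cap E_j|=1$ if $|i-j|=1$ and $E_i\cap E_j=\emptyset$ if $|i-j|\ge 2$; it has $n(r-1)+1$ vertices. A loose $r$-path of length $0$ is a single vertex. Each vertex is colored red or blue; an edge is (monochromatic) blue if all its vertices are blue. A blue subpath of length $k$ means $k$ consecutive edges all of which are blue. $F_k(r,n,j)$ is the number of red/blue colorings of the vertices (vertices are labeled) of a loose $r$-path with $n$ edges having exactly $j$ blue vertices and no blue subpath of length $k$; it is $0$ if $j<0$. *)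

theory Defs
  imports Complex_Main "HOL-Library.FuncSet"
begin

definition uniform_hypergraph :: "nat \<Rightarrow> 'v set \<Rightarrow> 'v set set \<Rightarrow> bool" where
  "uniform_hypergraph r V E \<longleftrightarrow> (\<forall>e\<in>E. e \<subseteq> V \<and> finite e \<and> card e = r)"

text \<open>
  \<^term>\<open>loose_path_edges r V Es\<close>: the hypergraph with vertex set \<^term>\<open>V\<close> and edge set
  \<^term>\<open>set Es\<close> is a loose path, and \<^term>\<open>Es\<close> lists its edges in path order (so its length is
  \<^term>\<open>length Es\<close>). There are no isolated vertices, except that the path of length 0 is a
  single vertex.
\<close>

definition loose_path_edges :: "nat \<Rightarrow> 'v set \<Rightarrow> 'v set list \<Rightarrow> bool" where
  "loose_path_edges r V Es \<longleftrightarrow>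
     uniform_hypergraph r V (set Es) \<and> distinct Es \<and>
     (if Es = [] then card V = 1 else V = \<Union> (set Es)) \<and>
     (\<forall>i<length Es. \<forall>j<length Es.
        (\<bar>int i - int j\<bar> = 1 \<longrightarrow> card (Es ! i \<inter> Es ! j) = 1) \<and>
        (\<bar>int i - int j\<bar> \<ge> 2 \<longrightarrow> Es ! i \<inter> Es ! j = {}))"

definition loose_path :: "nat \<Rightarrow> nat \<Rightarrow> 'v set \<Rightarrow> 'v set set \<Rightarrow> bool" where
  "loose_path r n V E \<longleftrightarrow> (\<exists>Es. set Es = E \<and> length Es = n \<and> loose_path_edges r V Es)"

datatype color = Red | Blue

definition blue_edge :: "('v \<Rightarrow> color) \<Rightarrow> 'v set \<Rightarrow> bool" where
  "blue_edge c e \<longleftrightarrow> (\<forall>v\<in>e. c v = Blue)"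

definition has_blue_subpath :: "nat \<Rightarrow> 'v set list \<Rightarrow> ('v \<Rightarrow> color) \<Rightarrow> bool" where
  "has_blue_subpath k Es c \<longleftrightarrow>
     (\<exists>s. s + k \<le> length Es \<and> (\<forall>i\<in>{s..<s + k}. blue_edge c (Es ! i)))"

definition good_colorings :: "nat \<Rightarrow> 'v set \<Rightarrow> 'v set list \<Rightarrow> int \<Rightarrow> ('v \<Rightarrow> color) set" where
  "good_colorings k V Es j =
     {c \<in> V \<rightarrow>\<^sub>E UNIV. int (card {v \<in> V. c v = Blue}) = j \<and> \<not> has_blue_subpath k Es c}"

text \<open>
  A concrete labeled loose path: vertices \<open>0, \<dots>, n (r - 1)\<close>, and the edges are the
  consecutive intervals of \<^term>\<open>r\<close> vertices overlapping in one vertex.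
\<close>

definition std_vertices :: "nat \<Rightarrow> nat \<Rightarrow> nat set" where
  "std_vertices r n = {0..n * (r - 1)}"

definition std_edges :: "nat \<Rightarrow> nat \<Rightarrow> nat set list" where
  "std_edges r n = map (\<lambda>i. {i * (r - 1)..(i + 1) * (r - 1)}) [0..<n]"

text \<open>
  The count is taken on the concrete path; by \<open>card_good_colorings_loose_path\<close> below every loose
  path with the same parameters, in any path order of its edges, gives the same number.
  It is 0 for negative \<open>j\<close>.
\<close>

definition F :: "nat \<Rightarrow> nat \<Rightarrow> nat \<Rightarrow> int \<Rightarrow> nat" where
  "F k r n j = card (good_colorings k (std_vertices r n) (std_edges r n) j)"

definition permissible :: "nat \<Rightarrow> nat \<Rightarrow> nat \<Rightarrow> int \<Rightarrow> bool" where
  "permissible r n k j \<longleftrightarrow>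
     int k * (int r - 1) + 1 \<le> j \<and>
     j \<le> int n * (int r - 1) + 1 - \<lceil>(real n - (real k - 1)) / (real k + 1)\<rceil>"

lemma F_neg: "j < 0 \<Longrightarrow> F k r n j = 0"
  by (auto simp: F_def good_colorings_def)

lemma std_edges_length [simp]: "length (std_edges r n) = n"
  by (simp add: std_edges_def)

lemma std_edges_nth: "i < n \<Longrightarrow> std_edges r n ! i = {i * (r - 1)..(i + 1) * (r - 1)}"
  by (simp add: std_edges_def)

lemma std_edges_Suc: "std_edges r (Suc n) = std_edges r n @ [{n * (r - 1)..Suc n * (r - 1)}]"
  by (simp add: std_edges_def)

lemma loose_path_std:
  assumes r: "r \<ge> 2"
  shows "loose_path_edges r (std_vertices r n) (std_edges r n)"
proof -
  define d where "d = r - 1"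
  have d: "d \<ge> 1" "r = Suc d" using r by (auto simp: d_def)
  have edge: "x \<le> n * d" if "x \<le> d + i * d" "i < n" for i x
  proof -
    have "Suc i * d \<le> n * d" using that(2) by (intro mult_le_mono1) simp
    then show ?thesis using that(1) by simp
  qed
  have nth: "std_edges r n ! i = {i * d..(i + 1) * d}" if "i < n" for i
    using that by (simp add: std_edges_nth d_def)
  have unif: "uniform_hypergraph r (std_vertices r n) (set (std_edges r n))"
    unfolding uniform_hypergraph_def std_vertices_def d_def[symmetric]
  proof
    fix e assume "e \<in> set (std_edges r n)"
    then obtain i where i: "i < n" "e = {i * d..(i + 1) * d}"
      by (auto simp: in_set_conv_nth nth)
    then show "e \<subseteq> {0..n * d} \<and> finite e \<and> card e = r"
      using edge[OF _ i(1)] by (auto simp: d(2))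
  qed
  have dist: "distinct (std_edges r n)"
    unfolding distinct_conv_nth using d(1) by (auto simp: nth Icc_eq_Icc)
  have cover: "if std_edges r n = [] then card (std_vertices r n) = 1
        else std_vertices r n = \<Union> (set (std_edges r n))"
  proof (cases n)
    case 0
    then show ?thesis by (simp add: std_edges_def std_vertices_def)
  next
    case (Suc m)
    have mem: "x \<in> \<Union> (set (std_edges r n))" if "i < n" "x \<in> {i * d..(i + 1) * d}" for i x
      using that nth[OF that(1)] nth_mem[of i "std_edges r n"] by (metis UnionI std_edges_length)
    have "x \<in> \<Union> (set (std_edges r n))" if x: "x \<le> n * d" for x
    proof (cases "x = n * d")
      case True
      then show ?thesis using mem[of m x] Suc by simp
    next
      case False
      then have "x div d < n" using x d(1) by (simp add: div_less_iff_less_mult)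
      moreover have "x div d * d \<le> x" by simp
      moreover have "x \<le> (x div d + 1) * d"
        using d(1) dividend_less_div_times[of d x] by simp
      ultimately show ?thesis using mem by simp
    qed
    moreover have "x \<le> n * d" if x: "x \<in> \<Union> (set (std_edges r n))" for x
    proof -
      obtain i where "i < n" "x \<in> {i * d..(i + 1) * d}"
        using x by (auto simp: in_set_conv_nth nth)
      then show ?thesis using edge[of x i] by simp
    qed
    moreover have ne: "std_edges r n \<noteq> []" using Suc by (simp add: std_edges_def)
    ultimately have "\<Union> (set (std_edges r n)) = {0..n * d}"
      unfolding set_eq_iff atLeastAtMost_iff using le0 by blast
    then show ?thesis using ne unfolding std_vertices_def d_def[symmetric] by simp
  qed
  have adj: "{i * d..(i + 1) * d} \<inter> {Suc i * d..(Suc i + 1) * d} = {Suc i * d}" for i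
    by auto
  have far: "{i * d..(i + 1) * d} \<inter> {j * d..(j + 1) * d} = {}" if "i + 2 \<le> j" for i j
  proof -
    have "(i + 2) * d \<le> j * d" using that by (rule mult_le_mono1)
    then show ?thesis using d(1) by auto
  qed
  have inter: "(\<bar>int i - int j\<bar> = 1 \<longrightarrow> card (std_edges r n ! i \<inter> std_edges r n ! j) = 1) \<and>
      (\<bar>int i - int j\<bar> \<ge> 2 \<longrightarrow> std_edges r n ! i \<inter> std_edges r n ! j = {})"
    if "i < n" "j < n" for i j
  proof (intro conjI impI)
    assume "\<bar>int i - int j\<bar> = 1"
    then have "j = Suc i \<or> i = Suc j" by linarith
    then show "card (std_edges r n ! i \<inter> std_edges r n ! j) = 1"
      unfolding nth[OF that(1)] nth[OF that(2)] using adj[of i] adj[of j]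
      by (elim disjE) (simp_all add: Int_commute)
  next
    assume "\<bar>int i - int j\<bar> \<ge> 2"
    then have "i + 2 \<le> j \<or> j + 2 \<le> i" by linarith
    then show "std_edges r n ! i \<inter> std_edges r n ! j = {}"
      unfolding nth[OF that(1)] nth[OF that(2)] using far[of i j] far[of j i] by blast
  qed
  show ?thesis
    unfolding loose_path_edges_def using unif dist cover inter by simp
qed

corollary loose_path_std_hypergraph:
  "r \<ge> 2 \<Longrightarrow> loose_path r n (std_vertices r n) (set (std_edges r n))"
  unfolding loose_path_def using loose_path_std std_edges_length by blast

lemma loose_path_edges_butlast:
  assumes "loose_path_edges r V (Es @ [e])" "Es \<noteq> []"
  shows "loose_path_edges r (\<Union> (set Es)) Es"
proof -
  have "(\<bar>int i - int j\<bar> = 1 \<longrightarrow> card (Es ! i \<inter> Es ! j) = 1) \<and>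
        (\<bar>int i - int j\<bar> \<ge> 2 \<longrightarrow> Es ! i \<inter> Es ! j = {})"
    if "i < length Es" "j < length Es" for i j
  proof -
    have "i < length (Es @ [e])" "j < length (Es @ [e])" using that by auto
    then have "(\<bar>int i - int j\<bar> = 1 \<longrightarrow> card ((Es @ [e]) ! i \<inter> (Es @ [e]) ! j) = 1) \<and>
        (\<bar>int i - int j\<bar> \<ge> 2 \<longrightarrow> (Es @ [e]) ! i \<inter> (Es @ [e]) ! j = {})"
      using assms(1) unfolding loose_path_edges_def by blast
    then show ?thesis using that by (simp add: nth_append)
  qed
  then show ?thesis
    using assms unfolding loose_path_edges_def uniform_hypergraph_def by auto
qed

lemma bij_betw_point:
  assumes "finite A" "finite B" "card A = card B" "p \<in> A" "q \<in> B"
  shows "\<exists>f. bij_betw f A B \<and> f p = q"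
proof -
  have "card (A - {p}) = card (B - {q})" using assms by simp
  then obtain g where g: "bij_betw g (A - {p}) (B - {q})"
    using assms finite_same_card_bij[of "A - {p}" "B - {q}"] by auto
  have "bij_betw (g(p := q)) (A - {p}) (B - {q})"
    using g by (rule bij_betw_cong[THEN iffD1, rotated]) auto
  moreover have "bij_betw (g(p := q)) {p} {q}" by (auto simp: bij_betw_def)
  ultimately have "bij_betw (g(p := q)) (A - {p} \<union> {p}) (B - {q} \<union> {q})"
    by (rule bij_betw_combine) auto
  moreover have "A - {p} \<union> {p} = A" "B - {q} \<union> {q} = B" using assms by auto
  ultimately show ?thesis by (metis fun_upd_same)
qed

lemma loose_path_iso_aux:
  assumes r: "r \<ge> 2"
  shows "loose_path_edges r V Es \<Longrightarrow> Es \<noteq> [] \<Longrightarrow> p \<in> last Es \<Longrightarrow> p \<notin> \<Union> (set (butlast Es)) \<Longrightarrow>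
    \<exists>f. bij_betw f V (std_vertices r (length Es)) \<and>
        map ((`) f) Es = std_edges r (length Es) \<and> f p = length Es * (r - 1)"
proof (induction Es arbitrary: V p rule: rev_induct)
  case Nil
  then show ?case by simp
next
  case (snoc e Es)
  define d where "d = r - 1"
  have d: "d \<ge> 1" "r = Suc d" using r by (auto simp: d_def)
  let ?n = "length Es"
  have V: "V = \<Union> (set Es) \<union> e"
    using snoc.prems(1) by (auto simp: loose_path_edges_def)
  have e: "finite e" "card e = r"
    using snoc.prems(1) by (auto simp: loose_path_edges_def uniform_hypergraph_def)
  have pe: "p \<in> e" "p \<notin> \<Union> (set Es)" using snoc.prems by auto
  show ?case
  proof (cases "Es = []")
    case True
    have "\<exists>f. bij_betw f e {0..d} \<and> f p = d"
      by (rule bij_betw_point) (use e d pe in auto)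
    then obtain f where f: "bij_betw f e {0..d}" "f p = d" by blast
    have "f ` e = {0..d}" using f by (simp add: bij_betw_def)
    then show ?thesis using True f V
      by (intro exI[of _ f]) (simp add: std_vertices_def std_edges_def d_def)
  next
    case False
    let ?V = "\<Union> (set Es)"
    have lp: "loose_path_edges r ?V Es"
      using loose_path_edges_butlast[OF snoc.prems(1) False] .
    have far: "Es ! i \<inter> e = {}" if "i + 1 < ?n" for i
    proof -
      have "\<bar>int i - int ?n\<bar> \<ge> 2" "i < length (Es @ [e])" "?n < length (Es @ [e])"
        using that by auto
      then have "(Es @ [e]) ! i \<inter> (Es @ [e]) ! ?n = {}"
        using snoc.prems(1) unfolding loose_path_edges_def by blast
      then show ?thesis using that by (simp add: nth_append)
    qed
    have "card (last Es \<inter> e) = 1"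
    proof -
      have "\<bar>int (?n - 1) - int ?n\<bar> = 1" "?n - 1 < length (Es @ [e])" "?n < length (Es @ [e])"
        using False by (auto simp: of_nat_diff Suc_le_eq)
      then have "card ((Es @ [e]) ! (?n - 1) \<inter> (Es @ [e]) ! ?n) = 1"
        using snoc.prems(1) unfolding loose_path_edges_def by blast
      then show ?thesis using False by (simp add: nth_append last_conv_nth)
    qed
    then obtain q where q: "last Es \<inter> e = {q}" by (auto simp: card_1_singleton_iff)
    have bl: "\<Union> (set (butlast Es)) \<inter> e = {}"
    proof -
      have "x \<inter> e = {}" if x: "x \<in> set (butlast Es)" for x
      proof -
        obtain i where "i < length (butlast Es)" "butlast Es ! i = x"
          using x in_set_conv_nth[of x "butlast Es"] by blast
        then show ?thesis using far[of i] by (simp add: nth_butlast)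
      qed
      then show ?thesis by auto
    qed
    have split: "?V = \<Union> (set (butlast Es)) \<union> last Es"
      by (subst append_butlast_last_id[OF False, symmetric]) (simp add: Un_commute)
    have Ve: "?V \<inter> e = {q}" using bl q split by blast
    have "q \<in> last Es" "q \<notin> \<Union> (set (butlast Es))" using q bl by auto
    from snoc.IH[OF lp False this] obtain f where
      f: "bij_betw f ?V (std_vertices r ?n)" "map ((`) f) Es = std_edges r ?n" "f q = ?n * d"
      unfolding d_def by blast
    have qe: "q \<in> e" "q \<in> ?V" using Ve by auto
    have "\<exists>g. bij_betw g (e - {q}) {?n * d + 1..Suc ?n * d} \<and> g p = Suc ?n * d"
    proof (rule bij_betw_point)
      show "card (e - {q}) = card {?n * d + 1..Suc ?n * d}" using e qe d by simp
      show "p \<in> e - {q}" using pe qe by auto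
    qed (use e d in auto)
    then obtain g where
      g: "bij_betw g (e - {q}) {?n * d + 1..Suc ?n * d}" "g p = Suc ?n * d" by blast
    define h where "h = (\<lambda>x. if x \<in> ?V then f x else g x)"
    have hV: "bij_betw h ?V {0..?n * d}"
      using f(1) unfolding std_vertices_def d_def[symmetric]
      by (rule bij_betw_cong[THEN iffD1, rotated]) (simp add: h_def)
    have he: "bij_betw h (e - {q}) {?n * d + 1..Suc ?n * d}"
      using g(1) by (rule bij_betw_cong[THEN iffD1, rotated]) (use Ve in \<open>auto simp: h_def\<close>)
    have "bij_betw h (?V \<union> (e - {q})) ({0..?n * d} \<union> {?n * d + 1..Suc ?n * d})"
      using hV he by (rule bij_betw_combine) auto
    moreover have "?V \<union> (e - {q}) = V" using V qe by auto
    moreover have "{0..?n * d} \<union> {?n * d + 1..Suc ?n * d} = {0..Suc ?n * d}" by auto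
    ultimately have b: "bij_betw h V {0..Suc ?n * d}" by simp
    have "h ` e = insert (h q) (h ` (e - {q}))" using qe by auto
    also have "h q = ?n * d" using qe f by (simp add: h_def)
    also have "h ` (e - {q}) = {?n * d + 1..Suc ?n * d}" using he by (simp add: bij_betw_def)
    also have "insert (?n * d) {?n * d + 1..Suc ?n * d} = {?n * d..Suc ?n * d}" by auto
    finally have im: "h ` e = {?n * d..Suc ?n * d}" .
    have "map ((`) h) Es = map ((`) f) Es"
      by (intro map_cong refl image_cong) (auto simp: h_def)
    then have m: "map ((`) h) (Es @ [e]) = std_edges r (Suc ?n)"
      using f(2) im by (simp add: std_edges_Suc d_def)
    have "h p = Suc ?n * d" using pe g by (simp add: h_def)
    then show ?thesis using b m by (intro exI[of _ h]) (simp add: std_vertices_def d_def)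
  qed
qed

lemma loose_path_iso:
  assumes r: "r \<ge> 2" and lp: "loose_path_edges r V Es"
  shows "\<exists>f. bij_betw f V (std_vertices r (length Es)) \<and>
             map ((`) f) Es = std_edges r (length Es)"
proof (cases "Es = []")
  case True
  then obtain v where "V = {v}"
    using lp by (auto simp: loose_path_edges_def card_1_singleton_iff)
  then show ?thesis using True
    by (intro exI[of _ "\<lambda>_. 0"]) (auto simp: bij_betw_def std_vertices_def std_edges_def)
next
  case False
  have "last Es \<in> set Es" using False by simp
  then have c: "finite (last Es)" "card (last Es) = r"
    using lp by (auto simp: loose_path_edges_def uniform_hypergraph_def)
  let ?L = "last Es" let ?B = "\<Union> (set (butlast Es))"
  let ?n = "length Es"
  have "card (?B \<inter> ?L) \<le> 1"
  proof (cases "?n \<ge> 2")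
    case True
    have "?B \<inter> ?L \<subseteq> Es ! (?n - 2) \<inter> Es ! (?n - 1)"
    proof
      fix x assume x: "x \<in> ?B \<inter> ?L"
      then obtain i where i: "i < ?n - 1" "x \<in> Es ! i"
        by (auto simp: in_set_conv_nth nth_butlast)
      have xl: "x \<in> Es ! (?n - 1)" using x False by (simp add: last_conv_nth)
      have "i = ?n - 2"
      proof (rule ccontr)
        assume "i \<noteq> ?n - 2"
        then have "\<bar>int i - int (?n - 1)\<bar> \<ge> 2" "i < ?n" "?n - 1 < ?n" using i True by auto
        then have "Es ! i \<inter> Es ! (?n - 1) = {}"
          using lp unfolding loose_path_edges_def by blast
        then show False using i xl by auto
      qed
      then show "x \<in> Es ! (?n - 2) \<inter> Es ! (?n - 1)" using i xl by auto
    qed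
    moreover have "card (Es ! (?n - 2) \<inter> Es ! (?n - 1)) = 1"
    proof -
      have "\<bar>int (?n - 2) - int (?n - 1)\<bar> = 1" "?n - 2 < ?n" "?n - 1 < ?n" using True by auto
      then show ?thesis using lp unfolding loose_path_edges_def by blast
    qed
    ultimately show ?thesis by (metis card_mono card.infinite zero_neq_one)
  next
    assume "\<not> 2 \<le> ?n"
    then have "butlast Es = []" using False by (cases Es; cases "tl Es") auto
    then show ?thesis by simp
  qed
  then have "\<exists>p. p \<in> ?L \<and> p \<notin> ?B"
    using c r by (metis Int_iff Int_absorb1 Suc_1 not_less_eq_eq subsetI)
  then show ?thesis using loose_path_iso_aux[OF r lp False] by blast
qed

lemma good_colorings_transport:
  assumes f: "bij_betw f V W" and Es: "\<Union> (set Es) \<subseteq> V"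
  shows "card (good_colorings k V Es j) = card (good_colorings k W (map ((`) f) Es) j)"
proof -
  let ?T = "\<lambda>c. restrict (c \<circ> f) V"
  have fV: "f ` V = W" "inj_on f V" using f by (auto simp: bij_betw_def)
  have blue: "has_blue_subpath k Es (?T c) \<longleftrightarrow> has_blue_subpath k (map ((`) f) Es) c" for c
  proof -
    have "blue_edge (?T c) (Es ! i) = blue_edge c (map ((`) f) Es ! i)" if "i < length Es" for i
    proof -
      have "Es ! i \<subseteq> V" using Es that by (meson Union_upper nth_mem subset_trans)
      then show ?thesis using that by (auto simp: blue_edge_def)
    qed
    then show ?thesis unfolding has_blue_subpath_def by fastforce
  qed
  have cnt: "card {v \<in> V. ?T c v = Blue} = card {w \<in> W. c w = Blue}" for c
  proof -
    have "f ` {v \<in> V. ?T c v = Blue} = {w \<in> W. c w = Blue}" using fV by auto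
    moreover have "inj_on f {v \<in> V. ?T c v = Blue}" using fV(2) by (rule inj_on_subset) auto
    ultimately show ?thesis using card_image by fastforce
  qed
  have "bij_betw ?T (good_colorings k W (map ((`) f) Es) j) (good_colorings k V Es j)"
    unfolding bij_betw_def
  proof
    show "inj_on ?T (good_colorings k W (map ((`) f) Es) j)"
    proof (rule inj_onI)
      fix c c' assume c: "c \<in> good_colorings k W (map ((`) f) Es) j"
        "c' \<in> good_colorings k W (map ((`) f) Es) j" and eq: "?T c = ?T c'"
      have "c w = c' w" if "w \<in> W" for w
      proof -
        have "w \<in> f ` V" using that fV(1) by simp
        then obtain v where "v \<in> V" "w = f v" by (rule imageE) blast
        then show ?thesis using fun_cong[OF eq, of v] by simp
      qed
      moreover have "c \<in> W \<rightarrow>\<^sub>E UNIV" "c' \<in> W \<rightarrow>\<^sub>E UNIV" using c by (auto simp: good_colorings_def)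
      ultimately show "c = c'" by (metis PiE_ext)
    qed
    show "?T ` good_colorings k W (map ((`) f) Es) j = good_colorings k V Es j"
    proof
      show "?T ` good_colorings k W (map ((`) f) Es) j \<subseteq> good_colorings k V Es j"
        using blue cnt by (auto simp: good_colorings_def PiE_def)
      show "good_colorings k V Es j \<subseteq> ?T ` good_colorings k W (map ((`) f) Es) j"
      proof
        fix c assume c: "c \<in> good_colorings k V Es j"
        define c' where "c' = restrict (c \<circ> inv_into V f) W"
        have "?T c' = c"
        proof
          fix v
          show "?T c' v = c v"
          proof (cases "v \<in> V")
            case True
            then show ?thesis using fV by (auto simp: c'_def)
          next
            case False
            then show ?thesis using c by (auto simp: good_colorings_def PiE_def extensional_def)
          qed
        qed
        moreover have "c' \<in> W \<rightarrow>\<^sub>E UNIV" by (auto simp: c'_def)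
        ultimately have "c' \<in> good_colorings k W (map ((`) f) Es) j"
          using c blue[of c'] cnt[of c'] unfolding good_colorings_def by auto
        then show "c \<in> ?T ` good_colorings k W (map ((`) f) Es) j"
          using \<open>?T c' = c\<close> by (metis imageI)
      qed
    qed
  qed
  then show ?thesis by (simp add: bij_betw_same_card)
qed

theorem card_good_colorings_loose_path:
  assumes "r \<ge> 2" and "loose_path_edges r V Es"
  shows "card (good_colorings k V Es j) = F k r (length Es) j"
proof -
  obtain f where f: "bij_betw f V (std_vertices r (length Es))"
      "map ((`) f) Es = std_edges r (length Es)"
    using loose_path_iso[OF assms] by blast
  have "\<Union> (set Es) \<subseteq> V"
    using assms(2) by (auto simp: loose_path_edges_def uniform_hypergraph_def)
  from good_colorings_transport[OF f(1) this, of k j] f(2) show ?thesis by (simp add: F_def)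
qed

end

theory Submission
  imports Defs
begin

text \<open>
  Read the path from its last edge. If some vertex of the last edge other than its first one is
  red, the first \<open>n - 1\<close> edges carry an arbitrary good colouring. Otherwise let \<open>l < k\<close> be
  the number of blue edges at the end of the path; the edge before them has a blue last vertex,
  and either an inner vertex of it is red (possible only for \<open>l > 0\<close>) or its first vertex is its
  only red one. In all cases the red vertex lies in every window of \<open>k\<close> edges that leaves the
  initial path before the edge (or, in the last case, before its predecessor), so that the colouring
  of this initial path is an arbitrary good one, and the remaining free colours give a binomial sum.
\<close>

section \<open>Good colourings as sets of blue vertices\<close>

definition avoiding :: "nat \<Rightarrow> nat \<Rightarrow> nat \<Rightarrow> nat set \<Rightarrow> bool" where
  "avoiding d k n B \<longleftrightarrow> \<not> (\<exists>s. s + k \<le> n \<and> {s * d..(s + k) * d} \<subseteq> B)"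

text \<open>A colouring is encoded by the set \<open>B\<close> of its blue vertices, and
  \<open>d\<close> stands for \<open>r - 1\<close>. For \<open>k \<ge> 1\<close>, a run of
  \<open>k\<close> edges is an interval of vertices, so a blue subpath is just an interval inside
  \<open>B\<close>.\<close>

definition good_sets :: "nat \<Rightarrow> nat \<Rightarrow> nat \<Rightarrow> int \<Rightarrow> nat set set" where
  "good_sets d k n j = {B. B \<subseteq> {0..n * d} \<and> int (card B) = j \<and> avoiding d k n B}"

lemma finite_good_sets [simp]: "finite (good_sets d k n j)"
  by (rule finite_subset[of _ "Pow {0..n * d}"]) (auto simp: good_sets_def)

text \<open>The count of edges is \<open>Suc k\<close> because a run of no edges has empty union,
  while the matching interval would still contain the point \<open>s * d\<close>.\<close>

lemma Union_consecutive_edges: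
  fixes d k s :: nat
  shows "(\<Union>i\<in>{s..<s + Suc k}. {i * d..(i + 1) * d}) = {s * d..(s + Suc k) * d}"
proof (induction k)
  case 0
  then show ?case by simp
next
  case (Suc k)
  have "{s..<s + Suc (Suc k)} = insert (s + Suc k) {s..<s + Suc k}" by auto
  then have "(\<Union>i\<in>{s..<s + Suc (Suc k)}. {i * d..(i + 1) * d}) =
      {(s + Suc k) * d..(s + Suc k + 1) * d} \<union> {s * d..(s + Suc k) * d}"
    using Suc by (simp del: One_nat_def)
  also have "\<dots> = {s * d..(s + Suc (Suc k)) * d}"
    by (auto simp: algebra_simps)
  finally show ?case .
qed

text \<open>For \<open>k = 0\<close> the left side always holds, whereas the right side would ask
  for a blue vertex; hence \<open>k \<ge> 1\<close>.\<close>

lemma has_blue_subpath_std_edges: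
  assumes "k \<ge> 1"
  shows "has_blue_subpath k (std_edges r n) c \<longleftrightarrow>
    (\<exists>s. s + k \<le> n \<and> {s * (r - 1)..(s + k) * (r - 1)} \<subseteq> {v. c v = Blue})"
proof -
  obtain k' where k: "k = Suc k'" using assms by (cases k) auto
  have "(\<forall>i\<in>{s..<s + k}. blue_edge c (std_edges r n ! i)) \<longleftrightarrow>
      {s * (r - 1)..(s + k) * (r - 1)} \<subseteq> {v. c v = Blue}" if "s + k \<le> n" for s
  proof -
    have "(\<forall>i\<in>{s..<s + k}. blue_edge c (std_edges r n ! i)) \<longleftrightarrow>
        (\<forall>i\<in>{s..<s + k}. {i * (r - 1)..(i + 1) * (r - 1)} \<subseteq> {v. c v = Blue})"
      using that by (intro ball_cong refl) (auto simp: blue_edge_def std_edges_nth)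
    also have "\<dots> \<longleftrightarrow> (\<Union>i\<in>{s..<s + k}. {i * (r - 1)..(i + 1) * (r - 1)}) \<subseteq> {v. c v = Blue}"
      by blast
    finally show ?thesis unfolding k Union_consecutive_edges .
  qed
  then show ?thesis unfolding has_blue_subpath_def std_edges_length by blast
qed

lemma F_eq_card_good_sets:
  assumes "k \<ge> 1"
  shows "F k r n j = card (good_sets (r - 1) k n j)"
proof -
  let ?V = "std_vertices r n"
  let ?f = "\<lambda>c. {v \<in> ?V. c v = Blue}"
  let ?g = "\<lambda>B. restrict (\<lambda>v. if v \<in> B then Blue else Red) ?V"
  \<comment> \<open>Every window consists of vertices of the path, so replacing all blue points by
    the blue vertices does not affect avoidance.\<close>
  have window: "{s * (r - 1)..(s + k) * (r - 1)} \<subseteq> ?V" if "s + k \<le> n" for s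
    using mult_le_mono1[OF that, of "r - 1"] by (auto simp: std_vertices_def)
  have avoid: "has_blue_subpath k (std_edges r n) c \<longleftrightarrow> \<not> avoiding (r - 1) k n (?f c)" for c
    unfolding has_blue_subpath_std_edges[OF assms] avoiding_def using window by blast
  have fg: "?f (?g B) = B" if "B \<subseteq> ?V" for B
    using that by auto
  have gf: "?g (?f c) = c" if "c \<in> ?V \<rightarrow>\<^sub>E UNIV" for c
  proof
    fix v show "?g (?f c) v = c v"
      using that by (cases "v \<in> ?V"; cases "c v") (auto simp: PiE_def extensional_def)
  qed
  have "bij_betw ?f (good_colorings k ?V (std_edges r n) j) (good_sets (r - 1) k n j)"
  proof (rule bij_betw_byWitness[where f' = ?g])
    show "\<forall>c\<in>good_colorings k ?V (std_edges r n) j. ?g (?f c) = c"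
      using gf by (auto simp: good_colorings_def)
    show "\<forall>B\<in>good_sets (r - 1) k n j. ?f (?g B) = B"
      using fg by (auto simp: good_sets_def std_vertices_def)
    show "?f ` good_colorings k ?V (std_edges r n) j \<subseteq> good_sets (r - 1) k n j"
      using avoid by (auto simp: good_colorings_def good_sets_def std_vertices_def)
    show "?g ` good_sets (r - 1) k n j \<subseteq> good_colorings k ?V (std_edges r n) j"
    proof (rule image_subsetI)
      fix B assume B: "B \<in> good_sets (r - 1) k n j"
      then have "?f (?g B) = B"
        by (intro fg) (simp add: good_sets_def std_vertices_def)
      then show "?g B \<in> good_colorings k ?V (std_edges r n) j"
        unfolding good_colorings_def mem_Collect_eq avoid using B by (simp add: good_sets_def)
    qed
  qed
  then show ?thesis unfolding F_def by (rule bij_betw_same_card)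
qed

section \<open>Cutting the path behind a red vertex\<close>

text \<open>The red vertex \<open>x\<close> blocks every window that leaves the first
  \<open>m\<close> edges: such a window ends at \<open>Suc m * d\<close> or later, hence not before
  \<open>x\<close>, and since it ends by \<open>n * d\<close> it starts no later than
  \<open>n * d - k * d\<close>, hence not after \<open>x\<close>. The remaining windows do not meet
  \<open>T\<close>.\<close>

lemma avoiding_Un_iff:
  assumes "m \<le> n" "B \<subseteq> {0..m * d}" "T \<subseteq> {m * d<..n * d}"
    and x: "x \<notin> T" "m * d < x" "x \<le> Suc m * d" "n * d \<le> x + k * d"
  shows "avoiding d k n (B \<union> T) \<longleftrightarrow> avoiding d k m B"
proof -
  have "s + k \<le> n \<and> {s * d..(s + k) * d} \<subseteq> B \<union> T \<longleftrightarrow>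
      s + k \<le> m \<and> {s * d..(s + k) * d} \<subseteq> B" for s
  proof (cases "s + k \<le> m")
    case True
    have "(s + k) * d \<le> m * d" using True by (rule mult_le_mono1)
    then have "x \<notin> T" if "x \<le> (s + k) * d" for x
      using that assms(3) by (meson greaterThanAtMost_iff le_trans linorder_not_le subsetD)
    then have "{s * d..(s + k) * d} \<inter> T = {}" by (meson atLeastAtMost_iff disjoint_iff)
    then show ?thesis using True assms(1) by auto
  next
    case False
    have "\<not> {s * d..(s + k) * d} \<subseteq> B \<union> T" if "s + k \<le> n"
    proof -
      have "(s + k) * d \<le> n * d" using that by (rule mult_le_mono1)
      then have "s * d \<le> x" using x(4) unfolding add_mult_distrib by linarith
      moreover have "Suc m * d \<le> (s + k) * d" using False by (intro mult_le_mono1) simp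
      moreover have "x \<notin> B" using x(2) assms(2) by auto
      ultimately show ?thesis
        using x(1,3) by (meson UnE atLeastAtMost_iff le_trans subsetD)
    qed
    then show ?thesis using False by blast
  qed
  then show ?thesis unfolding avoiding_def by blast
qed

text \<open>\<open>\<T>\<close> is a family of admissible blue patterns on the vertices behind
  \<open>m * d\<close>. As each pattern has a blocking red vertex, it can be glued to any good set
  of the first \<open>m\<close> edges, so the good sets counted are the pairs of a pattern and such
  a set. The joint \<open>m * d\<close> belongs to the initial path.\<close>

lemma card_good_sets_tail:
  assumes mn: "m \<le> n" and sub: "\<T> \<subseteq> Pow {m * d<..n * d}"
    and red: "\<And>T. T \<in> \<T> \<Longrightarrow> \<exists>x. x \<notin> T \<and> m * d < x \<and> x \<le> Suc m * d \<and> n * d \<le> x + k * d"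
  shows "card {B \<in> good_sets d k n j. B \<inter> {m * d<..n * d} \<in> \<T>} =
    (\<Sum>T\<in>\<T>. card (good_sets d k m (j - int (card T))))"
proof -
  let ?C = "{m * d<..n * d}"
  let ?S = "SIGMA T:\<T>. good_sets d k m (j - int (card T))"
  let ?D = "{B \<in> good_sets d k n j. B \<inter> ?C \<in> \<T>}"
  have "{0..b} = {0..a} \<union> {a<..b}" "{0..a} \<inter> {a<..b} = {}" if "a \<le> b" for a b :: nat
    using that by auto
  from this[OF mult_le_mono1[OF mn]]
  have V: "{0..n * d} = {0..m * d} \<union> ?C" "{0..m * d} \<inter> ?C = {}" .
  have mem: "B \<union> T \<in> good_sets d k n j \<longleftrightarrow> B \<in> good_sets d k m (j - int (card T))"
    if TB: "T \<in> \<T>" "B \<subseteq> {0..m * d}" for T B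
  proof -
    have T: "T \<subseteq> ?C" using TB(1) sub by blast
    obtain x where "x \<notin> T" "m * d < x" "x \<le> Suc m * d" "n * d \<le> x + k * d"
      using red[OF TB(1)] by blast
    then have "avoiding d k n (B \<union> T) \<longleftrightarrow> avoiding d k m B"
      by (rule avoiding_Un_iff[OF mn TB(2) T])
    moreover have "card (B \<union> T) = card B + card T"
    proof (rule card_Un_disjoint)
      show "finite B" "finite T"
        using TB(2) T finite_subset[OF _ finite_atLeastAtMost]
          finite_subset[OF _ finite_greaterThanAtMost] by blast+
      show "B \<inter> T = {}" using TB(2) T V(2) by blast
    qed
    moreover have "B \<union> T \<subseteq> {0..n * d}" using TB(2) T V(1) by blast
    ultimately show ?thesis using TB(2) by (auto simp: good_sets_def)
  qed
  have "bij_betw (\<lambda>(T, B). B \<union> T) ?S ?D"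
  proof (rule bij_betw_byWitness[where f' = "\<lambda>B. (B \<inter> ?C, B \<inter> {0..m * d})"])
    have split: "(B \<union> T) \<inter> ?C = T" "(B \<union> T) \<inter> {0..m * d} = B"
      if "T \<in> \<T>" "B \<subseteq> {0..m * d}" for T B
      using that sub V(2) by blast+
    have sub': "B \<subseteq> {0..m * d}" if "B \<in> good_sets d k m i" for B i
      using that by (simp add: good_sets_def)
    show "\<forall>a\<in>?S. (\<lambda>B. (B \<inter> ?C, B \<inter> {0..m * d})) ((\<lambda>(T, B). B \<union> T) a) = a"
      using split sub' by clarsimp
    have join: "B \<inter> {0..m * d} \<union> B \<inter> ?C = B" if "B \<in> good_sets d k n j" for B
      using that V(1) unfolding good_sets_def by blast
    show "\<forall>B\<in>?D. (\<lambda>(T, B). B \<union> T) (B \<inter> ?C, B \<inter> {0..m * d}) = B"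
      using join by simp
    show "(\<lambda>(T, B). B \<union> T) ` ?S \<subseteq> ?D"
    proof (rule image_subsetI, clarify)
      fix T B assume TB: "T \<in> \<T>" "B \<in> good_sets d k m (j - int (card T))"
      then show "B \<union> T \<in> good_sets d k n j \<and> (B \<union> T) \<inter> ?C \<in> \<T>"
        using mem[OF TB(1) sub'[OF TB(2)]] split(1)[OF TB(1) sub'[OF TB(2)]] by simp
    qed
    show "(\<lambda>B. (B \<inter> ?C, B \<inter> {0..m * d})) ` ?D \<subseteq> ?S"
    proof (rule image_subsetI)
      fix B assume B: "B \<in> ?D"
      then show "(B \<inter> ?C, B \<inter> {0..m * d}) \<in> ?S"
        using mem[of "B \<inter> ?C" "B \<inter> {0..m * d}"] join[of B] by auto
    qed
  qed
  then have "card ?D = card ?S" by (simp add: bij_betw_same_card)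
  also have "\<dots> = (\<Sum>T\<in>\<T>. card (good_sets d k m (j - int (card T))))"
    using finite_subset[OF sub] by (intro card_SigmaI) auto
  finally show ?thesis .
qed

section \<open>Sums over patterns as binomial sums\<close>

lemma sum_subsets_card_le:
  fixes g :: "nat \<Rightarrow> nat"
  assumes "finite X"
  shows "(\<Sum>U | U \<subseteq> X \<and> card U \<le> p. g (card U)) = (\<Sum>i=0..p. (card X choose i) * g i)"
proof -
  let ?S = "{U. U \<subseteq> X \<and> card U \<le> p}"
  have fin: "finite ?S" using assms by (auto intro: finite_subset[of _ "Pow X"])
  have "(\<Sum>U\<in>?S. g (card U)) = (\<Sum>i=0..p. \<Sum>U | U \<in> ?S \<and> card U = i. g (card U))"
    by (rule sum.group[symmetric]) (use fin in auto)
  also have "\<dots> = (\<Sum>i=0..p. (card X choose i) * g i)"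
  proof (rule sum.cong[OF refl])
    fix i assume "i \<in> {0..p}"
    then have "{U. U \<in> ?S \<and> card U = i} = {U. U \<subseteq> X \<and> card U = i}" by auto
    then show "(\<Sum>U | U \<in> ?S \<and> card U = i. g (card U)) = (card X choose i) * g i"
      using n_subsets[OF assms, of i] by simp
  qed
  finally show ?thesis .
qed

lemma sum_Pow_card:
  fixes g :: "nat \<Rightarrow> nat"
  assumes "finite X"
  shows "(\<Sum>U\<in>Pow X. g (card U)) = (\<Sum>i=0..card X. (card X choose i) * g i)"
proof -
  have "Pow X = {U. U \<subseteq> X \<and> card U \<le> card X}" using card_mono[OF assms] by auto
  then show ?thesis using sum_subsets_card_le[OF assms] by simp
qed

text \<open>This serves the cases where some vertex of \<open>X\<close> must be red: only the full
  size drops out. For empty \<open>X\<close> the truncated bound would leave the term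
  \<open>i = 0\<close>, while there is no proper subset.\<close>

lemma sum_proper_subsets_card:
  fixes g :: "nat \<Rightarrow> nat"
  assumes "finite X" "X \<noteq> {}"
  shows "(\<Sum>U\<in>Pow X - {X}. g (card U)) = (\<Sum>i=0..card X - 1. (card X choose i) * g i)"
proof -
  have "0 < card X" using assms by (simp add: card_gt_0_iff)
  then have "U \<subseteq> X \<and> U \<noteq> X \<longleftrightarrow> U \<subseteq> X \<and> card U \<le> card X - 1" for U
    using psubset_card_mono[OF assms(1), of U] unfolding psubset_eq
    by (cases "U = X"; cases "U \<subseteq> X") simp_all
  then have "Pow X - {X} = {U. U \<subseteq> X \<and> card U \<le> card X - 1}" by auto
  then show ?thesis using sum_subsets_card_le[OF assms(1)] by simp
qed

text \<open>\<open>W\<close> is the part of the tail that is forced to be blue; it only shifts the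
  number of blue vertices.\<close>

lemma sum_card_Un_disjoint:
  fixes g :: "nat \<Rightarrow> nat"
  assumes "finite X" "finite W" "X \<inter> W = {}" "\<U> \<subseteq> Pow X"
  shows "(\<Sum>T\<in>(\<lambda>U. U \<union> W) ` \<U>. g (card T)) = (\<Sum>U\<in>\<U>. g (card U + card W))"
proof -
  have "inj_on (\<lambda>U. U \<union> W) \<U>" using assms(3,4) by (intro inj_onI) blast
  moreover have "card (U \<union> W) = card U + card W" if "U \<in> \<U>" for U
  proof (rule card_Un_disjoint)
    have "U \<subseteq> X" using that assms(4) by blast
    then show "finite U" "U \<inter> W = {}" using assms(1,3) finite_subset by blast+
  qed (rule assms(2))
  ultimately show ?thesis by (simp add: sum.reindex)
qed

section \<open>The three kinds of tail\<close>

text \<open>The tail is the last edge without its first vertex. Any red vertex among these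
  \<open>d\<close> blocks, because a window is at least one edge long.\<close>

lemma card_good_sets_last_not_blue:
  assumes "d \<ge> 1" "k \<ge> 1"
  shows "card {B \<in> good_sets d k (Suc m) j. \<not> {m * d<..Suc m * d} \<subseteq> B} =
    (\<Sum>i=0..d - 1. (d choose i) * card (good_sets d k m (j - int i)))"
proof -
  let ?C = "{m * d<..Suc m * d}"
  have c: "card ?C = d" "?C \<noteq> {}" using assms(1) by auto
  have kd: "k * d \<ge> d" using assms by simp
  have "card {B \<in> good_sets d k (Suc m) j. B \<inter> ?C \<in> Pow ?C - {?C}} =
      (\<Sum>T\<in>Pow ?C - {?C}. card (good_sets d k m (j - int (card T))))"
  proof (rule card_good_sets_tail)
    fix T assume "T \<in> Pow ?C - {?C}"
    then obtain x where x: "x \<in> ?C" "x \<notin> T" by blast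
    moreover have "Suc m * d \<le> x + k * d"
      using x(1) kd unfolding greaterThanAtMost_iff mult_Suc by linarith
    ultimately show "\<exists>x. x \<notin> T \<and> m * d < x \<and> x \<le> Suc m * d \<and> Suc m * d \<le> x + k * d"
      by auto
  qed auto
  also have "{B \<in> good_sets d k (Suc m) j. B \<inter> ?C \<in> Pow ?C - {?C}} =
      {B \<in> good_sets d k (Suc m) j. \<not> ?C \<subseteq> B}" by blast
  finally show ?thesis
    using sum_proper_subsets_card[of ?C "\<lambda>i. card (good_sets d k m (j - int i))"] c by simp
qed

text \<open>The blocking vertex is the joint \<open>Suc m * d\<close> itself. The
  \<open>d - 1\<close> inner vertices of the edge before it are free, and the
  \<open>(n - Suc m) * d\<close> vertices behind it are forced to be blue.\<close>

lemma card_good_sets_red_joint: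
  assumes d: "d \<ge> 1" and mn: "m < n" "n \<le> Suc m + k"
  shows "card {B \<in> good_sets d k n j. {Suc m * d<..n * d} \<subseteq> B \<and> Suc m * d \<notin> B} =
    (\<Sum>i=0..d - 1. ((d - 1) choose i) *
       card (good_sets d k m (j - int i - int (n - Suc m) * int d)))"
proof -
  let ?C = "{m * d<..n * d}" and ?W = "{Suc m * d<..n * d}" and ?I = "{m * d<..<Suc m * d}"
  let ?T = "(\<lambda>U. U \<union> ?W) ` Pow ?I"
  have le: "Suc m * d \<le> n * d" using mn by (intro mult_le_mono1) simp
  have cW: "card ?W = (n - Suc m) * d" by (simp add: diff_mult_distrib)
  have shift: "j - int (i + card ?W) = j - int i - int (n - Suc m) * int d" for i
    unfolding cW by simp
  have cI: "card ?I = d - 1" by simp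
  have C: "?C = ?I \<union> insert (Suc m * d) ?W" using le d by auto
  have "n * d \<le> (Suc m + k) * d" using mn(2) by (rule mult_le_mono1)
  then have nd: "n * d \<le> Suc m * d + k * d" by (simp add: algebra_simps)
  have "card {B \<in> good_sets d k n j. B \<inter> ?C \<in> ?T} =
      (\<Sum>T\<in>?T. card (good_sets d k m (j - int (card T))))"
  proof (rule card_good_sets_tail)
    show "\<exists>x. x \<notin> T \<and> m * d < x \<and> x \<le> Suc m * d \<and> n * d \<le> x + k * d" if "T \<in> ?T" for T
      by (rule exI[of _ "Suc m * d"]) (use that nd d in auto)
    show "?T \<subseteq> Pow ?C" unfolding C by blast
  qed (use mn in simp)
  also have "{B \<in> good_sets d k n j. B \<inter> ?C \<in> ?T} =
      {B \<in> good_sets d k n j. ?W \<subseteq> B \<and> Suc m * d \<notin> B}"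
  proof -
    have "B \<inter> ?C \<in> ?T \<longleftrightarrow> ?W \<subseteq> B \<and> Suc m * d \<notin> B" for B
    proof
      assume "B \<inter> ?C \<in> ?T"
      then obtain U where U: "U \<subseteq> ?I" "B \<inter> ?C = U \<union> ?W" by blast
      moreover have "Suc m * d \<notin> U \<union> ?W" using U(1) by auto
      moreover have "Suc m * d \<in> ?C" unfolding C by blast
      ultimately show "?W \<subseteq> B \<and> Suc m * d \<notin> B" by blast
    next
      assume "?W \<subseteq> B \<and> Suc m * d \<notin> B"
      then have "B \<inter> ?C = (B \<inter> ?I) \<union> ?W" unfolding C by blast
      then show "B \<inter> ?C \<in> ?T" by blast
    qed
    then show ?thesis by blast
  qed
  also have "(\<Sum>T\<in>?T. card (good_sets d k m (j - int (card T)))) =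
      (\<Sum>U\<in>Pow ?I. card (good_sets d k m (j - int (card U + card ?W))))"
    by (rule sum_card_Un_disjoint[where X = ?I]) auto
  also have "\<dots> = (\<Sum>i=0..card ?I. (card ?I choose i) *
      card (good_sets d k m (j - int (i + card ?W))))"
    by (rule sum_Pow_card) simp
  finally show ?thesis unfolding shift cI .
qed

text \<open>Here the joint \<open>Suc m * d\<close> is blue as well, which gives the extra
  \<open>- 1\<close>, and the blocking vertex is some red inner vertex of the edge before it. The
  inner vertices are not all blue, so the sum stops at \<open>d - 2\<close>. As the blocking vertex
  is only known to lie behind \<open>m * d\<close>, the bound on \<open>n\<close> is one tighter
  than for a red joint.\<close>

lemma card_good_sets_red_inner:
  assumes d: "d \<ge> 2" and mn: "m < n" "n \<le> m + k"
  shows "card {B \<in> good_sets d k n j. {Suc m * d..n * d} \<subseteq> B \<and> \<not> {m * d<..<Suc m * d} \<subseteq> B} =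
    (\<Sum>i=0..d - 2. ((d - 1) choose i) *
       card (good_sets d k m (j - int (n - Suc m) * int d - 1 - int i)))"
proof -
  let ?C = "{m * d<..n * d}" and ?W = "{Suc m * d..n * d}" and ?I = "{m * d<..<Suc m * d}"
  let ?T = "(\<lambda>U. U \<union> ?W) ` (Pow ?I - {?I})"
  have le: "Suc m * d \<le> n * d" using mn by (intro mult_le_mono1) simp
  have cW: "card ?W = (n - Suc m) * d + 1" using le by (simp add: diff_mult_distrib)
  have shift: "j - int (i + card ?W) = j - int (n - Suc m) * int d - 1 - int i" for i
    unfolding cW of_nat_add of_nat_mult by simp
  have cI: "card ?I = d - 1" by simp
  then have I: "?I \<noteq> {}" using d by (metis card.empty diff_is_0_eq not_less_eq_eq numeral_2_eq_2 One_nat_def)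
  have C: "?C = ?I \<union> ?W" using le d by auto
  have disj: "?I \<inter> ?W = {}" by auto
  have "n * d \<le> (m + k) * d" using mn(2) by (rule mult_le_mono1)
  then have nd: "n * d \<le> m * d + k * d" by (simp add: algebra_simps)
  have "card {B \<in> good_sets d k n j. B \<inter> ?C \<in> ?T} =
      (\<Sum>T\<in>?T. card (good_sets d k m (j - int (card T))))"
  proof (rule card_good_sets_tail)
    fix T assume "T \<in> ?T"
    then obtain U x where U: "T = U \<union> ?W" "x \<in> ?I" "x \<notin> U" by blast
    then have "x \<notin> T" using disj by blast
    then show "\<exists>x. x \<notin> T \<and> m * d < x \<and> x \<le> Suc m * d \<and> n * d \<le> x + k * d"
      using U(2) nd by (intro exI[of _ x]) auto
  next
    show "?T \<subseteq> Pow ?C" unfolding C by blast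
  qed (use mn in simp)
  also have "{B \<in> good_sets d k n j. B \<inter> ?C \<in> ?T} =
      {B \<in> good_sets d k n j. ?W \<subseteq> B \<and> \<not> ?I \<subseteq> B}"
  proof -
    have "B \<inter> ?C \<in> ?T \<longleftrightarrow> ?W \<subseteq> B \<and> \<not> ?I \<subseteq> B" for B
    proof
      assume "B \<inter> ?C \<in> ?T"
      then obtain U where "U \<subseteq> ?I" "U \<noteq> ?I" "B \<inter> ?C = U \<union> ?W" by blast
      then show "?W \<subseteq> B \<and> \<not> ?I \<subseteq> B" using disj unfolding C by blast
    next
      assume W: "?W \<subseteq> B \<and> \<not> ?I \<subseteq> B"
      then have "B \<inter> ?C = (B \<inter> ?I) \<union> ?W" unfolding C by blast
      moreover have "B \<inter> ?I \<in> Pow ?I - {?I}" using W by blast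
      ultimately show "B \<inter> ?C \<in> ?T" by (rule image_eqI)
    qed
    then show ?thesis by blast
  qed
  also have "(\<Sum>T\<in>?T. card (good_sets d k m (j - int (card T)))) =
      (\<Sum>U\<in>Pow ?I - {?I}. card (good_sets d k m (j - int (card U + card ?W))))"
    using disj by (intro sum_card_Un_disjoint[where X = ?I]) auto
  also have "\<dots> = (\<Sum>i=0..card ?I - 1. (card ?I choose i) *
      card (good_sets d k m (j - int (i + card ?W))))"
    using I by (intro sum_proper_subsets_card) simp_all
  finally show ?thesis unfolding shift cI diff_diff_left one_add_one .
qed

section \<open>Peeling blue edges off the end of the path\<close>

theorem theorem3p10:
  fixes k r n :: nat and j :: int
  assumes "k > 1" and "r > 3" and "n > k" and "permissible r n k j"
  shows "F k r n j =
      (\<Sum>i=0..r - 2. ((r - 2) choose i) * F k r (n - 2) (j - int i - (int r - 1)))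
    + (\<Sum>i=0..r - 2. ((r - 1) choose i) * F k r (n - 1) (j - int i))
    + (\<Sum>l=1..k - 1. \<Sum>i=0..r - 3. ((r - 2) choose i) *
         F k r (n - (l + 1)) (j - int l * (int r - 1) - 1 - int i))
    + (\<Sum>l=1..k - 1. \<Sum>i=0..r - 2. ((r - 2) choose i) *
         F k r (n - (l + 2)) (j - (int l + 1) * (int r - 1) - int i))"
proof -
  define d where "d = r - 1"
  have d: "d \<ge> 2" "r - 1 = d" "r - 2 = d - 1" "r - 3 = d - 2" "int r - 1 = int d"
    using assms(2) by (auto simp: d_def)
  have F: "F k r m i = card (good_sets d k m i)" for m i
    using F_eq_card_good_sets[of k r m i] assms(1) d by simp
  let ?G = "good_sets d k n j"
  \<comment> \<open>\<open>h l\<close> leaves the first vertex of the last \<open>l\<close> edges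
    undecided. \<open>P l\<close> and \<open>Q l\<close> belong to exactly \<open>l\<close> blue
    edges at the end: in \<open>P l\<close> the edge before them is red only at its first vertex, in
    \<open>Q l\<close> it has a red inner vertex.\<close>
  define h where "h l = card {B \<in> ?G. {(n - l) * d<..n * d} \<subseteq> B}" for l
  define P where "P l = (\<Sum>i=0..d - 1. ((d - 1) choose i) *
      card (good_sets d k (n - (l + 2)) (j - (int l + 1) * int d - int i)))" for l
  define Q where "Q l = (\<Sum>i=0..d - 2. ((d - 1) choose i) *
      card (good_sets d k (n - (l + 1)) (j - int l * int d - 1 - int i)))" for l
  define R where "R = (\<Sum>i=0..d - 1. (d choose i) * card (good_sets d k (n - 1) (j - int i)))"
  have P: "card {B \<in> ?G. {(n - Suc l) * d<..n * d} \<subseteq> B \<and> (n - Suc l) * d \<notin> B} = P l"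
    if "l < k" for l
  proof -
    \<comment> \<open>From \<open>l < k < n\<close> follows \<open>l + 2 \<le> n\<close>, so no
      subtraction is truncated.\<close>
    have m: "n - (l + 2) < n" "n \<le> Suc (n - (l + 2)) + k" "Suc (n - (l + 2)) = n - Suc l"
        "n - (n - Suc l) = Suc l"
      using that assms by auto
    show ?thesis
      using card_good_sets_red_joint[OF _ m(1,2), of d j] d unfolding m(3,4) P_def
      by (simp add: algebra_simps)
  qed
  have Q: "card {B \<in> ?G. {(n - l) * d..n * d} \<subseteq> B \<and> \<not> {(n - Suc l) * d<..<(n - l) * d} \<subseteq> B} = Q l"
    if "l < k" for l
  proof -
    have m: "n - (l + 1) < n" "n \<le> (n - (l + 1)) + k" "Suc (n - (l + 1)) = n - l"
        "n - (n - l) = l"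
      using that assms by auto
    show ?thesis
      using card_good_sets_red_inner[OF d(1) m(1,2), of j] unfolding m(3,4) Q_def by simp
  qed
  \<comment> \<open>Decide the open vertex \<open>?x\<close>: red gives \<open>P l\<close>; blue
    with a red inner vertex in the edge before it gives \<open>Q (Suc l)\<close>; otherwise one more
    edge is blue up to its own first vertex.\<close>
  have step: "h (Suc l) = P l + Q (Suc l) + h (Suc (Suc l))" if "Suc l < k" for l
  proof -
    let ?m = "n - Suc (Suc l)"
    let ?W = "{(n - Suc l) * d<..n * d}" and ?x = "(n - Suc l) * d"
    let ?W' = "{?x..n * d}" and ?I = "{?m * d<..<?x}"
    let ?P = "{B \<in> ?G. ?W \<subseteq> B \<and> ?x \<notin> B}" and ?Q = "{B \<in> ?G. ?W' \<subseteq> B \<and> \<not> ?I \<subseteq> B}"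
    let ?H = "{B \<in> ?G. {?m * d<..n * d} \<subseteq> B}"
    have "?x = Suc ?m * d" using that assms by (simp add: Suc_diff_Suc)
    then have "?m * d < ?x" using d by simp
    moreover have "?x \<le> n * d" by simp
    moreover have "{b..c} = insert b {b<..c}" "{a<..c} = {a<..<b} \<union> insert b {b<..c}"
      if "a < b" "b \<le> c" for a b c :: nat
      using that by auto
    ultimately have W: "?W' = insert ?x ?W" "{?m * d<..n * d} = ?I \<union> insert ?x ?W" by blast+
    have fin: "finite {B \<in> ?G. p B}" for p by simp
    have "(?P \<union> ?Q) \<inter> ?H = {}" "?P \<inter> ?Q = {}" unfolding W by blast+
    then have "card (?P \<union> ?Q \<union> ?H) = card ?P + card ?Q + card ?H"
      by (simp only: card_Un_disjoint fin finite_UnI)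
    moreover have "{B \<in> ?G. ?W \<subseteq> B} = ?P \<union> ?Q \<union> ?H" unfolding W by blast
    ultimately show ?thesis unfolding h_def P[OF Suc_lessD[OF that]] Q[OF that] by (simp only:)
  qed
  \<comment> \<open>The peeling ends here: a blue vertex \<open>(n - k) * d\<close> would complete
    \<open>k\<close> blue edges, so the open vertex must be red.\<close>
  have last: "h k = P (k - 1)"
  proof -
    obtain k' where k': "k = Suc k'" using assms by (cases k) auto
    have "(n - k) * d \<notin> B" if "B \<in> ?G" "{(n - k) * d<..n * d} \<subseteq> B" for B
    proof
      assume "(n - k) * d \<in> B"
      moreover have "{(n - k) * d..(n - k + k) * d} = insert ((n - k) * d) {(n - k) * d<..n * d}"
        using assms by auto
      ultimately have "{(n - k) * d..(n - k + k) * d} \<subseteq> B" using that by simp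
      moreover have "n - k + k \<le> n" using assms by simp
      ultimately show False using that(1) unfolding good_sets_def avoiding_def by blast
    qed
    then have "{B \<in> ?G. {(n - k) * d<..n * d} \<subseteq> B} =
        {B \<in> ?G. {(n - k) * d<..n * d} \<subseteq> B \<and> (n - k) * d \<notin> B}" by blast
    then show ?thesis unfolding h_def using P[of k'] k' by simp
  qed
  \<comment> \<open>After \<open>a\<close> steps only \<open>P 0\<close> to \<open>P (a - 1)\<close>
    have been split off. Adding \<open>P a\<close> on the left lets both sums run to
    \<open>a\<close>, and at \<open>a = k - 1\<close> it cancels against \<open>h k\<close>.\<close>
  have "h 1 + P a = P 0 + (\<Sum>l=1..a. Q l) + (\<Sum>l=1..a. P l) + h (Suc a)" if "a < k" for a
    using that
  proof (induction a)
    case 0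
    then show ?case by simp
  next
    case (Suc a)
    then show ?case using step[of a] by simp
  qed
  from this[of "k - 1"] have h1: "h 1 = P 0 + (\<Sum>l=1..k - 1. Q l) + (\<Sum>l=1..k - 1. P l)"
    using last assms(1) by simp
  have "card ?G = R + h 1"
  proof -
    have n: "Suc (n - 1) = n" using assms by simp
    let ?W = "{(n - 1) * d<..n * d}"
    have "card ({B \<in> ?G. \<not> ?W \<subseteq> B} \<union> {B \<in> ?G. ?W \<subseteq> B}) =
        card {B \<in> ?G. \<not> ?W \<subseteq> B} + card {B \<in> ?G. ?W \<subseteq> B}"
      by (rule card_Un_disjoint) auto
    moreover have "{B \<in> ?G. \<not> ?W \<subseteq> B} \<union> {B \<in> ?G. ?W \<subseteq> B} = ?G" by blast
    moreover have "card {B \<in> ?G. \<not> ?W \<subseteq> B} = R"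
      using card_good_sets_last_not_blue[of d k "n - 1" j] d assms unfolding n R_def by simp
    ultimately show ?thesis unfolding h_def by (simp only:)
  qed
  then have "card ?G = P 0 + R + (\<Sum>l=1..k - 1. Q l) + (\<Sum>l=1..k - 1. P l)"
    using h1 by simp
  \<comment> \<open>The case \<open>l = 0\<close> of the red joint is the first sum of the theorem;
    its last sum starts at \<open>l = 1\<close>.\<close>
  moreover have "P 0 = (\<Sum>i=0..d - 1. ((d - 1) choose i) *
      card (good_sets d k (n - 2) (j - int i - int d)))"
    unfolding P_def by (simp add: algebra_simps numeral_2_eq_2)
  ultimately show ?thesis unfolding F d P_def[symmetric] Q_def[symmetric] R_def[symmetric] by simp
qed

end
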